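(* For any $n\ge 1$, the affine index polynomial of the virtual knot $VK_n$ is $P_{VK_n}(t)=2-t^{2}-t^{-2}$.
   Context: Affine index polynomial. Let $D$ be an oriented virtual knot diagram and $C(D)$ its set of classical crossings, with signs $\operatorname{sgn}(c)\in\{+1,-1\}$ (with both strands directed upwards, $c$ is positive when the over-strand runs from lower left to upper right, negative when the over-strand runs from lower right to upper left). Arcs are the edges of $D$ between consecutive classical crossings (virtual crossings are ignored). Label the arcs by integers so that at each classical crossing, drawn with both strands directed upwards, if the incoming lower-left arc has label $a$ and the incoming lower-right arc has label $b$, then the outgoing upper-right arc (continuation of the strand labelled $a$) has label $a-1$ and the outgoing upper-left arc (continuation of the strand labelled $b$) has label $b+1$. (So the strand carrying $a$ is the over-strand at a positive crossing and the under-strand at a negative crossing.) Put $W_D(c)=\operatorname{sgn}(c)(a-b-1)$. The affine index polynomial is $P_D(t)=\sum_{c\in C(D)}\operatorname{sgn}(c)\,(t^{W_D(c)}-1)$; it is an invariant of the virtual knot represented by $D$. The virtual knots $VK_n$. A virtual knot is determined by its signed Gauss code: the cyclic sequence of passages through classical crossings along the orientation, each marked $O$ (over) or $U$ (under), together with the signs of the crossings. For $n\ge1$, $VK_n$ is the virtual knot with $6n+2$ classical crossings $c_0^1,c_0^2$ and $c_i^1,\dots,c_i^6$ ($1\le i\le n$), with signs $\operatorname{sgn}(c_0^1)=\operatorname{sgn}(c_0^2)=+1$, $\operatorname{sgn}(c_i^1)=\operatorname{sgn}(c_i^4)=\operatorname{sgn}(c_i^5)=\operatorname{sgn}(c_i^6)=+1$,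 $\operatorname{sgn}(c_i^2)=\operatorname{sgn}(c_i^3)=-1$, and the following Gauss code. Define words $\beta_i = U c_i^1\; U c_i^3$, $\gamma_i = U c_i^4\; U c_i^2$, $\delta_i = U c_i^6\; U c_i^5\; O c_i^2\; O c_i^1\; O c_i^5\; O c_i^6\; O c_i^3\; O c_i^4$. The cyclic Gauss code of $VK_n$ is $$U c_0^1\; U c_0^2\; \beta_1\; O c_0^2\; O c_0^1\;\; \delta_n\,\gamma_n\;\; \delta_{n-1}\,\beta_n\,\gamma_{n-1}\;\; \delta_{n-2}\,\beta_{n-1}\,\gamma_{n-2}\;\cdots\;\delta_1\,\beta_2\,\gamma_1 ,$$ i.e. after $\delta_n\gamma_n$ one has the words $\delta_k\,\beta_{k+1}\,\gamma_k$ for $k=n-1,n-2,\dots,1$ in this order (no such words if $n=1$). *)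

theory Defs
  imports "HOL-Library.Poly_Mapping"
begin

text \<open>
  An oriented virtual knot diagram is represented by its signed Gauss code: the cyclic word of
  passages through classical crossings, read along the orientation from some base point, together
  with the signs of the crossings.  Virtual crossings leave no trace in the code.
\<close>

datatype level = Over | Under

record 'c gauss_code =
  passages :: "(level \<times> 'c) list"
  sgn_of :: "'c \<Rightarrow> int"

definition crossings :: "'c gauss_code \<Rightarrow> 'c set" where
  "crossings D = snd ` set (passages D)"

definition valid_gauss_code :: "'c gauss_code \<Rightarrow> bool" where
  "valid_gauss_code D \<longleftrightarrow>
     distinct (passages D) \<and>
     set (passages D) = UNIV \<times> crossings D \<and>
     (\<forall>c \<in> crossings D. sgn_of D c \<in> {1, -1})"

text \<open>
  The arcs are numbered by the positions of the word: arc \<open>k\<close> is the one running into the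
  \<open>k\<close>-th passage, and the \<open>k\<close>-th passage runs out into arc \<open>k + 1\<close>, modulo the length of the word.
  In a valid code the position of a passage is unique.
\<close>

definition in_arc :: "'c gauss_code \<Rightarrow> level \<Rightarrow> 'c \<Rightarrow> nat" where
  "in_arc D s c = (THE k. k < length (passages D) \<and> passages D ! k = (s, c))"

definition out_arc :: "'c gauss_code \<Rightarrow> level \<Rightarrow> 'c \<Rightarrow> nat" where
  "out_arc D s c = Suc (in_arc D s c) mod length (passages D)"

text \<open>
  Draw the crossing with both strands directed upwards.  The strand entering at the lower left
  is the over-strand at a positive crossing and the under-strand at a negative one; the strand
  entering at the lower right is the other one.
\<close>

definition left_strand :: "'c gauss_code \<Rightarrow> 'c \<Rightarrow> level" where
  "left_strand D c = (if sgn_of D c = 1 then Over else Under)"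

definition right_strand :: "'c gauss_code \<Rightarrow> 'c \<Rightarrow> level" where
  "right_strand D c = (if sgn_of D c = 1 then Under else Over)"

definition arc_labelling :: "'c gauss_code \<Rightarrow> (nat \<Rightarrow> int) \<Rightarrow> bool" where
  "arc_labelling D l \<longleftrightarrow> (\<forall>c \<in> crossings D.
     l (out_arc D (left_strand D c) c) = l (in_arc D (left_strand D c) c) - 1 \<and>
     l (out_arc D (right_strand D c) c) = l (in_arc D (right_strand D c) c) + 1)"

definition crossing_weight :: "'c gauss_code \<Rightarrow> (nat \<Rightarrow> int) \<Rightarrow> 'c \<Rightarrow> int" where
  "crossing_weight D l c =
     sgn_of D c * (l (in_arc D (left_strand D c) c) - l (in_arc D (right_strand D c) c) - 1)"

text \<open>
  Integral Laurent polynomials form the group ring of the integers over themselves: finitely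
  supported functions from exponents to coefficients, with convolution as multiplication.
\<close>

type_synonym laurent_poly = "int \<Rightarrow>\<^sub>0 int"

definition t_pow :: "int \<Rightarrow> laurent_poly" where
  "t_pow k = Poly_Mapping.single k 1"

definition labelled_index_poly :: "'c gauss_code \<Rightarrow> (nat \<Rightarrow> int) \<Rightarrow> laurent_poly" where
  "labelled_index_poly D l =
     (\<Sum>c \<in> crossings D. of_int (sgn_of D c) * (t_pow (crossing_weight D l c) - 1))"

text \<open>
  A valid code has an arc labelling, unique on its arcs up to an additive constant, which cancels
  in the weights; so all labellings give the same polynomial.  The definite description is
  determined only when a labelling exists and the polynomial does not depend on its choice.
\<close>

definition affine_index_poly :: "'c gauss_code \<Rightarrow> laurent_poly" where
  "affine_index_poly D = (THE p. \<exists>l. arc_labelling D l \<and> p = labelled_index_poly D l)"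

text \<open>The crossing \<open>c\<^sub>i\<^sup>j\<close> is encoded as the pair \<open>(i, j)\<close>.\<close>

type_synonym vk_word = "(level \<times> nat \<times> nat) list"

definition vk_beta :: "nat \<Rightarrow> vk_word" where
  "vk_beta i = [(Under, i, 1), (Under, i, 3)]"

definition vk_gamma :: "nat \<Rightarrow> vk_word" where
  "vk_gamma i = [(Under, i, 4), (Under, i, 2)]"

definition vk_delta :: "nat \<Rightarrow> vk_word" where
  "vk_delta i =
     [(Under, i, 6), (Under, i, 5), (Over, i, 2), (Over, i, 1),
      (Over, i, 5), (Over, i, 6), (Over, i, 3), (Over, i, 4)]"

definition vk_word :: "nat \<Rightarrow> vk_word" where
  "vk_word n =
     [(Under, 0, 1), (Under, 0, 2)] @ vk_beta 1 @ [(Over, 0, 2), (Over, 0, 1)] @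
     vk_delta n @ vk_gamma n @
     concat (map (\<lambda>k. vk_delta k @ vk_beta (k + 1) @ vk_gamma k) (rev [1..<n]))"

definition vk_sgn :: "nat \<times> nat \<Rightarrow> int" where
  "vk_sgn = (\<lambda>(i, j). if i \<ge> 1 \<and> j \<in> {2, 3} then -1 else 1)"

definition VK :: "nat \<Rightarrow> (nat \<times> nat) gauss_code" where
  "VK n = \<lparr>passages = vk_word n, sgn_of = vk_sgn\<rparr>"

lemma UNIV_level: "UNIV = {Over, Under}"
  using level.exhaust by auto

lemma set_vk_word:
  assumes "n \<ge> 1"
  shows "set (vk_word n) = UNIV \<times> ({(0, 1), (0, 2)} \<union> {1..n} \<times> {1..6})"
proof -
  define B where "B i = set (vk_beta i)" for i
  define G where "G i = set (vk_gamma i)" for i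
  define E where "E i = set (vk_delta i)" for i
  define Z where "Z = {(Under, 0, 1), (Under, 0, 2), (Over, 0, 2), (Over, 0::nat, 1::nat)}"
  have last: "{1..n} = insert n {1..<n}"
    using assms by auto
  have first: "{1..n} = insert 1 (Suc ` {1..<n})"
    using assms by (auto simp: image_Suc_atLeastLessThan)
  have first_B: "(\<Union>k\<in>{1..n}. B k) = B 1 \<union> (\<Union>k\<in>{1..<n}. B (Suc k))"
    unfolding first by (simp only: UN_insert image_image)
  have last_G: "(\<Union>k\<in>{1..n}. G k) = G n \<union> (\<Union>k\<in>{1..<n}. G k)"
    unfolding last by (simp only: UN_insert)
  have last_E: "(\<Union>k\<in>{1..n}. E k) = E n \<union> (\<Union>k\<in>{1..<n}. E k)"
    unfolding last by (simp only: UN_insert)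
  have "set (vk_word n) =
      Z \<union> B 1 \<union> E n \<union> G n \<union> (\<Union>k\<in>{1..<n}. E k \<union> B (Suc k) \<union> G k)"
    unfolding vk_word_def B_def G_def E_def Z_def by (simp add: Un_ac insert_commute)
  then have "set (vk_word n) = Z \<union> (\<Union>i\<in>{1..n}. B i \<union> G i \<union> E i)"
    by (simp only: UN_Un_distrib first_B last_G last_E Un_ac)
  moreover have "B i \<union> G i \<union> E i = UNIV \<times> {i} \<times> {1..6}" for i
  proof -
    have "{1..6::nat} = {1, 2, 3, 4, 5, 6}"
      by auto
    then show ?thesis
      unfolding B_def G_def E_def vk_beta_def vk_gamma_def vk_delta_def UNIV_level by auto
  qed
  moreover have "Z = UNIV \<times> {(0, 1), (0, 2)}"
    unfolding Z_def UNIV_level by auto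
  ultimately have "set (vk_word n) =
      UNIV \<times> {(0, 1), (0, 2)} \<union> (\<Union>i\<in>{1..n}. UNIV \<times> {i} \<times> {1..6})"
    by (simp only:)
  then show ?thesis
    by auto
qed

lemma crossings_VK:
  assumes "n \<ge> 1"
  shows "crossings (VK n) = {(0, 1), (0, 2)} \<union> {1..n} \<times> {1..6}"
  unfolding crossings_def VK_def gauss_code.simps set_vk_word[OF assms] by simp

lemma card_crossings_VK:
  assumes "n \<ge> 1"
  shows "card (crossings (VK n)) = 6 * n + 2"
  unfolding crossings_VK[OF assms] by (subst card_Un_disjoint) auto

lemma length_vk_word: "n \<ge> 1 \<Longrightarrow> length (vk_word n) = 2 * (6 * n + 2)"
  by (simp add: vk_word_def vk_beta_def vk_gamma_def vk_delta_def length_concat o_def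
      sum_list_triv)

lemma valid_VK:
  assumes "n \<ge> 1"
  shows "valid_gauss_code (VK n)"
proof -
  have "card (UNIV :: level set) = 2"
    by (simp add: UNIV_level)
  moreover have "set (vk_word n) = UNIV \<times> crossings (VK n)"
    using set_vk_word[OF assms] crossings_VK[OF assms] by simp
  ultimately have "card (set (vk_word n)) = length (vk_word n)"
    by (simp only: card_cartesian_product card_crossings_VK[OF assms] length_vk_word[OF assms])
  then have "distinct (vk_word n)"
    by (rule card_distinct)
  then show ?thesis
    using set_vk_word[OF assms] crossings_VK[OF assms]
    by (auto simp: valid_gauss_code_def VK_def vk_sgn_def)
qed

end

theory Submission
  imports Defs
begin

text \<open>
  The label of an arc changes along the knot by a step that depends only on the passage: an
  over-passage of a crossing \<open>c\<close> lowers it by the sign of \<open>c\<close>, an under-passage raises it by that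
  sign.  The two passages of each crossing cancel, so the partial sums of the steps close up after
  one turn and label the arcs; any other labelling differs from them by a constant.  Hence every
  valid code has a well-defined polynomial (\<open>affine_index_poly_height\<close>), in which \<open>c\<close> has the
  weight \<open>h(O) - h(U) - sgn c\<close>, where \<open>h(O)\<close> and \<open>h(U)\<close> are the partial sums just before its two
  passages.

  In \<open>VK n\<close> each of the words \<open>\<beta>\<close>, \<open>\<gamma>\<close>, \<open>\<delta>\<close> has total step zero.  The partial sum is therefore
  zero at the start of all of them except \<open>\<beta> 1\<close>, which lies between the two under-passages and the
  two over-passages of the crossings \<open>c\<^sub>0\<close> and so starts at \<open>2\<close>.  If \<open>\<beta> i\<close> starts at \<open>h\<close>,
  the crossings \<open>c\<^sub>i\<^sup>1\<close>, ..., \<open>c\<^sub>i\<^sup>6\<close> have the weights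
  \<open>2 - h\<close>, \<open>2\<close>, \<open>-h\<close>, \<open>0\<close>, \<open>0\<close>, \<open>0\<close>, and they contribute
  \<open>(t\<^bsup>2-h\<^esup> - 1) - (t\<^bsup>2\<^esup> - 1) - (t\<^bsup>-h\<^esup> - 1)\<close>.  This vanishes for \<open>h = 0\<close> and is
  \<open>2 - t\<^bsup>2\<^esup> - t\<^bsup>-2\<^esup>\<close> for \<open>h = 2\<close>, that is, for \<open>i = 1\<close>;
  \<open>c\<^sub>0\<^sup>1\<close> and \<open>c\<^sub>0\<^sup>2\<close> have weight zero.
\<close>

section \<open>Arc labellings as partial sums\<close>

fun step :: "('c \<Rightarrow> int) \<Rightarrow> level \<times> 'c \<Rightarrow> int" where
  "step sg (Over, c) = - sg c"
| "step sg (Under, c) = sg c"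

definition rise :: "('c \<Rightarrow> int) \<Rightarrow> (level \<times> 'c) list \<Rightarrow> int" where
  "rise sg w = sum_list (map (step sg) w)"

lemma rise_simps [simp]:
  "rise sg [] = 0"
  "rise sg (p # w) = step sg p + rise sg w"
  "rise sg (v @ w) = rise sg v + rise sg w"
  by (simp_all add: rise_def)

lemma rise_concat_eq_0: "(\<And>w. w \<in> set ws \<Longrightarrow> rise sg w = 0) \<Longrightarrow> rise sg (concat ws) = 0"
  by (induction ws) auto

definition height :: "'c gauss_code \<Rightarrow> nat \<Rightarrow> int" where
  "height D k = rise (sgn_of D) (take k (passages D))"

lemma height_Suc:
  "k < length (passages D) \<Longrightarrow> height D (Suc k) = height D k + step (sgn_of D) (passages D ! k)"
  by (simp add: height_def take_Suc_conv_app_nth)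

lemma rise_passages:
  assumes "valid_gauss_code D"
  shows "rise (sgn_of D) (passages D) = 0"
proof -
  have "rise (sgn_of D) (passages D) = (\<Sum>p\<in>UNIV \<times> crossings D. step (sgn_of D) p)"
    using assms unfolding rise_def valid_gauss_code_def
    by (metis sum_list_distinct_conv_sum_set)
  also have "\<dots> = (\<Sum>s\<in>UNIV. \<Sum>c\<in>crossings D. step (sgn_of D) (s, c))"
    by (simp add: sum.cartesian_product)
  also have "\<dots> = 0"
    by (simp add: UNIV_level sum_negf)
  finally show ?thesis .
qed

lemma in_arc_nth:
  assumes "valid_gauss_code D" "k < length (passages D)" "passages D ! k = (s, c)"
  shows "in_arc D s c = k"
  unfolding in_arc_def
proof (rule the_equality)
  show "j = k" if "j < length (passages D) \<and> passages D ! j = (s, c)" for j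
    using assms that by (metis nth_eq_iff_index_eq valid_gauss_code_def)
qed (use assms in simp)

lemma in_arc_valid:
  assumes "valid_gauss_code D" "c \<in> crossings D"
  shows "in_arc D s c < length (passages D)" "passages D ! in_arc D s c = (s, c)"
proof -
  have "(s, c) \<in> set (passages D)"
    using assms by (simp add: valid_gauss_code_def)
  then obtain k where "k < length (passages D)" "passages D ! k = (s, c)"
    by (metis in_set_conv_nth)
  with in_arc_nth[OF assms(1) this]
  show "in_arc D s c < length (passages D)" "passages D ! in_arc D s c = (s, c)"
    by simp_all
qed

text \<open>
  A passage occurs only once in a valid code, so its height can be read off from any factorisation
  of the code that exhibits it; neither its position nor the rest of the code has to be known.
\<close>
lemma height_in_arc:
  assumes "valid_gauss_code D" "passages D = xs @ w @ ys" "j < length w" "w ! j = (s, c)"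
  shows "height D (in_arc D s c) = rise (sgn_of D) xs + rise (sgn_of D) (take j w)"
proof -
  have "in_arc D s c = length xs + j"
    using assms by (intro in_arc_nth) (simp_all add: nth_append)
  then show ?thesis
    using assms by (simp add: height_def)
qed

text \<open>
  The left strand always descends and the right strand always ascends; read off by level instead
  of side, the two conditions at a crossing become one condition for each of its passages.  Every
  position of the word is exactly one such passage.
\<close>
lemma arc_labelling_iff:
  assumes D: "valid_gauss_code D"
  shows "arc_labelling D l \<longleftrightarrow> (\<forall>k<length (passages D).
    l (Suc k mod length (passages D)) = l k + step (sgn_of D) (passages D ! k))"
    (is "_ \<longleftrightarrow> (\<forall>k<?N. ?P k)")
proof -
  have sgn: "sgn_of D c = 1 \<or> sgn_of D c = -1" if "c \<in> crossings D" for c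
    using D that by (auto simp: valid_gauss_code_def)
  have "arc_labelling D l \<longleftrightarrow> (\<forall>c\<in>crossings D. \<forall>s. ?P (in_arc D s c))"
    unfolding arc_labelling_def
  proof (intro ball_cong refl)
    fix c assume c: "c \<in> crossings D"
    have all_level: "(\<forall>s. Q s) \<longleftrightarrow> Q Over \<and> Q Under" for Q
      by (metis level.exhaust)
    show "(l (out_arc D (left_strand D c) c) = l (in_arc D (left_strand D c) c) - 1 \<and>
        l (out_arc D (right_strand D c) c) = l (in_arc D (right_strand D c) c) + 1) \<longleftrightarrow>
      (\<forall>s. ?P (in_arc D s c))"
      using sgn[OF c] in_arc_valid(2)[OF D c]
      by (auto simp: all_level left_strand_def right_strand_def out_arc_def)
  qed
  also have "\<dots> \<longleftrightarrow> (\<forall>k<?N. ?P k)"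
  proof (intro iffI allI impI ballI)
    fix k assume all: "\<forall>c\<in>crossings D. \<forall>s. ?P (in_arc D s c)" and k: "k < ?N"
    obtain s c where sc: "passages D ! k = (s, c)"
      by fastforce
    then have "c \<in> crossings D"
      using nth_mem[OF k] by (force simp: crossings_def)
    with all show "?P k"
      using in_arc_nth[OF D k sc] by metis
  next
    fix c s assume "\<forall>k<?N. ?P k" "c \<in> crossings D"
    then show "?P (in_arc D s c)"
      using in_arc_valid(1)[OF D] by blast
  qed
  finally show ?thesis .
qed

lemma arc_labelling_height:
  assumes "valid_gauss_code D"
  shows "arc_labelling D (height D)"
  unfolding arc_labelling_iff[OF assms]
proof (intro allI impI)
  fix k assume k: "k < length (passages D)"
  have "height D (Suc k mod length (passages D)) = height D (Suc k)"
  proof (cases "Suc k = length (passages D)")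
    case True
    then show ?thesis
      using rise_passages[OF assms] by (simp add: height_def)
  qed (use k in simp)
  then show "height D (Suc k mod length (passages D)) =
      height D k + step (sgn_of D) (passages D ! k)"
    using height_Suc[OF k] by simp
qed

lemma arc_labelling_eq_height:
  assumes "valid_gauss_code D" "arc_labelling D l" "k < length (passages D)"
  shows "l k = l 0 + height D k"
  using assms(3)
proof (induction k)
  case 0
  then show ?case by (simp add: height_def)
next
  case (Suc k)
  then have "l (Suc k) = l k + step (sgn_of D) (passages D ! k)"
    using assms arc_labelling_iff by (metis Suc_lessD mod_less)
  with Suc show ?case
    by (simp add: height_Suc)
qed

lemma crossing_weight_eq:
  assumes "valid_gauss_code D" "c \<in> crossings D"
  shows "crossing_weight D l c = l (in_arc D Over c) - l (in_arc D Under c) - sgn_of D c"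
  using assms
  by (auto simp: crossing_weight_def left_strand_def right_strand_def valid_gauss_code_def)

theorem affine_index_poly_height:
  assumes D: "valid_gauss_code D"
  shows "affine_index_poly D = labelled_index_poly D (height D)"
  unfolding affine_index_poly_def
proof (rule the_equality)
  show "\<exists>l. arc_labelling D l \<and> labelled_index_poly D (height D) = labelled_index_poly D l"
    using arc_labelling_height[OF D] by blast
next
  fix p assume "\<exists>l. arc_labelling D l \<and> p = labelled_index_poly D l"
  then obtain l where l: "arc_labelling D l" and p: "p = labelled_index_poly D l"
    by blast
  have "crossing_weight D l c = crossing_weight D (height D) c" if c: "c \<in> crossings D" for c
    using arc_labelling_eq_height[OF D l] in_arc_valid(1)[OF D c]
    by (simp add: crossing_weight_eq[OF D c])
  then show "p = labelled_index_poly D (height D)"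
    by (simp add: p labelled_index_poly_def)
qed

section \<open>Heights in the knots \<open>VK n\<close>\<close>

lemma vk_sgn_simps [simp]:
  "vk_sgn (0, j) = 1"
  "i \<ge> 1 \<Longrightarrow> vk_sgn (i, j) = (if j = 2 \<or> j = 3 then -1 else 1)"
  by (auto simp: vk_sgn_def)

lemma VK_simps [simp]: "passages (VK n) = vk_word n" "sgn_of (VK n) = vk_sgn"
  by (simp_all add: VK_def)

lemma rise_vk_blocks:
  assumes "i \<ge> 1"
  shows "rise vk_sgn (vk_beta i) = 0" "rise vk_sgn (vk_gamma i) = 0" "rise vk_sgn (vk_delta i) = 0"
  using assms by (simp_all add: vk_beta_def vk_gamma_def vk_delta_def)

definition vk_head :: "nat \<Rightarrow> vk_word" where
  "vk_head n = [(Under, 0, 1), (Under, 0, 2)] @ vk_beta 1 @ [(Over, 0, 2), (Over, 0, 1)] @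
     vk_delta n @ vk_gamma n"

definition vk_block :: "nat \<Rightarrow> vk_word" where
  "vk_block k = vk_delta k @ vk_beta (k + 1) @ vk_gamma k"

lemma vk_word_eq: "vk_word n = vk_head n @ concat (map vk_block (rev [1..<n]))"
  by (simp add: vk_word_def vk_head_def vk_block_def[abs_def])

lemma vk_block_split:
  assumes "1 \<le> k" "k < n"
  obtains xs ys where "vk_word n = xs @ vk_block k @ ys" "rise vk_sgn xs = 0"
proof -
  have "k \<in> set (rev [1..<n])"
    using assms by simp
  then obtain us vs where split: "rev [1..<n] = us @ k # vs"
    by (meson split_list)
  have "set us \<subseteq> set (rev [1..<n])"
    unfolding split by auto
  then have "rise vk_sgn (concat (map vk_block us)) = 0"
    by (intro rise_concat_eq_0) (auto simp: vk_block_def rise_vk_blocks)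
  moreover have "rise vk_sgn (vk_head n) = 0"
    using assms by (simp add: vk_head_def rise_vk_blocks)
  moreover have "vk_word n =
      (vk_head n @ concat (map vk_block us)) @ vk_block k @ concat (map vk_block vs)"
    unfolding vk_word_eq split by simp
  ultimately show thesis
    using that[of "vk_head n @ concat (map vk_block us)"] by simp
qed

lemma vk_delta_split:
  assumes "1 \<le> i" "i \<le> n"
  obtains xs ys where "vk_word n = xs @ vk_delta i @ ys" "rise vk_sgn xs = 0"
proof (cases "i = n")
  case True
  show thesis
    by (rule that[of "[(Under, 0, 1), (Under, 0, 2)] @ vk_beta 1 @ [(Over, 0, 2), (Over, 0, 1)]"])
      (simp_all add: vk_word_eq vk_head_def True rise_vk_blocks)
next
  case False
  with assms obtain xs ys where "vk_word n = xs @ vk_block i @ ys" "rise vk_sgn xs = 0"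
    using vk_block_split[of i n] by auto
  then show thesis
    using that[of xs] by (simp add: vk_block_def)
qed

lemma vk_gamma_split:
  assumes "1 \<le> i" "i \<le> n"
  obtains xs ys where "vk_word n = xs @ vk_gamma i @ ys" "rise vk_sgn xs = 0"
proof (cases "i = n")
  case True
  show thesis
    by (rule that[of "[(Under, 0, 1), (Under, 0, 2)] @ vk_beta 1 @ [(Over, 0, 2), (Over, 0, 1)] @
          vk_delta n"])
      (use assms in \<open>simp_all add: vk_word_eq vk_head_def True rise_vk_blocks\<close>)
next
  case False
  with assms obtain xs ys where "vk_word n = xs @ vk_block i @ ys" "rise vk_sgn xs = 0"
    using vk_block_split[of i n] by auto
  then show thesis
    using that[of "xs @ vk_delta i @ vk_beta (i + 1)"] assms
    by (simp add: vk_block_def rise_vk_blocks)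
qed

text \<open>
  The only block away from height zero is \<open>\<beta> 1\<close>: it follows the under-passages of both
  \<open>c\<^sub>0\<^sup>1\<close> and \<open>c\<^sub>0\<^sup>2\<close> and precedes their over-passages.
\<close>
lemma vk_beta_split:
  assumes "1 \<le> i" "i \<le> n"
  obtains xs ys where "vk_word n = xs @ vk_beta i @ ys" "rise vk_sgn xs = (if i = 1 then 2 else 0)"
proof (cases "i = 1")
  case True
  show thesis
    by (rule that[of "[(Under, 0, 1), (Under, 0, 2)]"]) (simp_all add: vk_word_eq vk_head_def True)
next
  case False
  \<comment> \<open>For \<open>i > 1\<close> the word \<open>\<beta> i\<close> sits in the block of index \<open>i - 1\<close>.\<close>
  with assms have "1 \<le> i - 1" "i - 1 < n"
    by auto
  then obtain xs ys where "vk_word n = xs @ vk_block (i - 1) @ ys" "rise vk_sgn xs = 0"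
    by (rule vk_block_split)
  then show thesis
    using that[of "xs @ vk_delta (i - 1)"] assms False
    by (simp add: vk_block_def rise_vk_blocks)
qed

lemma weight_VK_0:
  assumes "n \<ge> 1"
  shows "crossing_weight (VK n) (height (VK n)) (0, 1) = 0"
    and "crossing_weight (VK n) (height (VK n)) (0, 2) = 0"
proof -
  note D = valid_VK[OF assms]
  have "passages (VK n) = [] @ vk_head n @ concat (map vk_block (rev [1..<n]))"
    by (simp add: vk_word_eq)
  note h = height_in_arc[OF D this]
  have "height (VK n) (in_arc (VK n) Under (0, 1)) = 0"
    by (subst h[of 0]) (simp_all add: vk_head_def)
  moreover have "height (VK n) (in_arc (VK n) Under (0, 2)) = 1"
    by (subst h[of 1]) (simp_all add: vk_head_def)
  moreover have "height (VK n) (in_arc (VK n) Over (0, 2)) = 2"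
    by (subst h[of 4]) (simp_all add: vk_head_def vk_beta_def)
  moreover have "height (VK n) (in_arc (VK n) Over (0, 1)) = 1"
    by (subst h[of 5]) (simp_all add: vk_head_def vk_beta_def)
  moreover have "(0, 1) \<in> crossings (VK n)" "(0, 2) \<in> crossings (VK n)"
    by (simp_all add: crossings_VK[OF assms])
  ultimately show "crossing_weight (VK n) (height (VK n)) (0, 1) = 0"
    and "crossing_weight (VK n) (height (VK n)) (0, 2) = 0"
    by (simp_all add: crossing_weight_eq[OF D])
qed

lemma weight_VK:
  assumes "1 \<le> i" "i \<le> n"
  defines "W \<equiv> (\<lambda>j. crossing_weight (VK n) (height (VK n)) (i, j))"
  defines "h \<equiv> if i = 1 then 2 else 0"
  shows "W 1 = 2 - h" "W 2 = 2" "W 3 = - h" "W 4 = 0" "W 5 = 0" "W 6 = 0"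
proof -
  have n: "n \<ge> 1"
    using assms by simp
  note D = valid_VK[OF n]
  let ?H = "\<lambda>s j. height (VK n) (in_arc (VK n) s (i, j))"
  have W: "W j = ?H Over j - ?H Under j - vk_sgn (i, j)" if "j \<in> {1..6}" for j
    using that assms(1,2) by (simp add: W_def crossing_weight_eq[OF D] crossings_VK[OF n])
  obtain xs ys where "vk_word n = xs @ vk_beta i @ ys" and xs: "rise vk_sgn xs = h"
    using vk_beta_split[OF assms(1,2)] unfolding h_def by metis
  then have "passages (VK n) = xs @ vk_beta i @ ys"
    by simp
  note b = height_in_arc[OF D this]
  have beta: "?H Under 1 = h" "?H Under 3 = h + 1"
    using assms(1) xs
    by (subst b[of 0], simp_all add: vk_beta_def)
      (subst b[of 1], simp_all add: vk_beta_def)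
  obtain xs ys where "vk_word n = xs @ vk_gamma i @ ys" and xs: "rise vk_sgn xs = 0"
    using vk_gamma_split[OF assms(1,2)] by metis
  then have "passages (VK n) = xs @ vk_gamma i @ ys"
    by simp
  note g = height_in_arc[OF D this]
  have gamma: "?H Under 4 = 0" "?H Under 2 = 1"
    using assms(1) xs
    by (subst g[of 0], simp_all add: vk_gamma_def)
      (subst g[of 1], simp_all add: vk_gamma_def)
  obtain xs ys where "vk_word n = xs @ vk_delta i @ ys" and xs: "rise vk_sgn xs = 0"
    using vk_delta_split[OF assms(1,2)] by metis
  then have "passages (VK n) = xs @ vk_delta i @ ys"
    by simp
  note d = height_in_arc[OF D this]
  have "?H Under 6 = 0"
    using assms(1) xs by (subst d[of 0]) (simp_all add: vk_delta_def)
  moreover have "?H Under 5 = 1"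
    using assms(1) xs by (subst d[of 1]) (simp_all add: vk_delta_def)
  moreover have "?H Over 2 = 2"
    using assms(1) xs by (subst d[of 2]) (simp_all add: vk_delta_def)
  moreover have "?H Over 1 = 3"
    using assms(1) xs by (subst d[of 3]) (simp_all add: vk_delta_def)
  moreover have "?H Over 5 = 2"
    using assms(1) xs by (subst d[of 4]) (simp_all add: vk_delta_def)
  moreover have "?H Over 6 = 1"
    using assms(1) xs by (subst d[of 5]) (simp_all add: vk_delta_def)
  moreover have "?H Over 3 = 0"
    using assms(1) xs by (subst d[of 6]) (simp_all add: vk_delta_def)
  moreover have "?H Over 4 = 1"
    using assms(1) xs by (subst d[of 7]) (simp_all add: vk_delta_def)
  ultimately show "W 1 = 2 - h" "W 2 = 2" "W 3 = - h" "W 4 = 0" "W 5 = 0" "W 6 = 0"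
    using assms(1) beta gamma by (simp_all add: W)
qed

section \<open>The affine index polynomial of \<open>VK n\<close>\<close>

lemma t_pow_0: "t_pow 0 = 1"
  by (simp add: t_pow_def)

theorem proposition5p1:
  fixes n :: nat
  assumes "n \<ge> 1"
  shows "affine_index_poly (VK n) = 2 - t_pow 2 - t_pow (-2)"
proof -
  define f where
    "f c = of_int (vk_sgn c) * (t_pow (crossing_weight (VK n) (height (VK n)) c) - 1)" for c
  have f0: "f (0, 1) = 0" "f (0, 2) = 0"
    using weight_VK_0[OF assms] by (simp_all add: f_def t_pow_0)
  have six: "{1..6::nat} = {1, 2, 3, 4, 5, 6}"
    by auto
  have fi: "(\<Sum>j\<in>{1..6}. f (i, j)) = (if i = 1 then 2 - t_pow 2 - t_pow (-2) else 0)"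
    if "i \<in> {1..n}" for i
    using that weight_VK[of i n] unfolding six by (auto simp: f_def t_pow_0)
  have "affine_index_poly (VK n) = (\<Sum>c\<in>crossings (VK n). f c)"
    by (simp add: affine_index_poly_height[OF valid_VK[OF assms]] labelled_index_poly_def f_def)
  also have "\<dots> = (\<Sum>c\<in>{(0, 1), (0, 2)}. f c) + (\<Sum>c\<in>{1..n} \<times> {1..6}. f c)"
    unfolding crossings_VK[OF assms] by (rule sum.union_disjoint) auto
  also have "\<dots> = (\<Sum>i\<in>{1..n}. \<Sum>j\<in>{1..6}. f (i, j))"
    using f0 by (simp add: sum.cartesian_product)
  also have "\<dots> = (\<Sum>i\<in>{1..n}. if i = 1 then 2 - t_pow 2 - t_pow (-2) else 0)"
    using fi by (rule sum.cong[OF refl])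
  also have "\<dots> = 2 - t_pow 2 - t_pow (-2)"
    using assms by simp
  finally show ?thesis .
qed

end
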